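(* Let $v\ne0$ in $\mathbb C^n\sim\mathbb R^{2n}$ and $p=(v^t\mathbf x)^d\in\mathbb C[\mathbf x]_d$. Let $u_1,\dots,u_{2n}\in\mathbb C^n$ be an orthonormal $\mathbb R$-basis of $\mathbb C^n$ for the inner product $\langle\cdot,\cdot\rangle_v$ with $u_1=\frac{v}{\sqrt d\,\|v\|}$. Then $$\mathbf q_i=\sqrt d\,\|v\|^{-d+1}(u_i^t\mathbf x)(v^t\mathbf x)^{d-1},\quad i=1,\dots,2n,$$ is an orthonormal basis of $T_p\mathcal V^{n,d}$ for the inner product $\langle\cdot,\cdot\rangle_d^{\mathbb R}$.
   Context: $\mathbb C[\mathbf x]_d$ is the space of homogeneous polynomials of degree $d$ in $\mathbf x=(x_1,\dots,x_n)$; $d>2$. Writing $\mathbf p=\sum_{|\alpha|=d}\binom d\alpha p_\alpha\mathbf x^\alpha$, $\mathbf q=\sum_{|\alpha|=d}\binom d\alpha q_\alpha\mathbf x^\alpha$, the apolar product is $\langle\mathbf p,\mathbf q\rangle_d=\sum_{|\alpha|=d}\binom d\alpha\bar p_\alpha q_\alpha$, and $\langle\mathbf p,\mathbf q\rangle_d^{\mathbb R}=\Re\langle\mathbf p,\mathbf q\rangle_d$ is a real inner product on $\mathbb C[\mathbf x]_d$ regarded as an $\mathbb R$-vector space. The Veronese manifold is $\mathcal V^{n,d}=\{(v^t\mathbf x)^d: v\in\mathbb C^n\setminus\{0\}\}$, regarded as a real manifold, with tangent space $T_p\mathcal V^{n,d}=\{(u^t\mathbf x)(v^t\mathbf x)^{d-1}:u\in\mathbb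 C^n\}$ at $p=(v^t\mathbf x)^d$, an $\mathbb R$-vector space of dimension $2n$. For $v\in\mathbb C^n\setminus\{0\}$, the real inner product $\langle\cdot,\cdot\rangle_v$ on $\mathbb C^n\sim\mathbb R^{2n}$ is $$\langle u,u'\rangle_v=\Re\big(u^*u'+(d-1)(u^*v)(v^*u')\|v\|^{-2}\big).$$ *)

theory Defs
  imports "HOL-Analysis.Analysis" "HOL-Analysis.Finite_Function_Topology"
begin

text \<open>Polynomials over the complex numbers in the variables \<open>x\<^sub>i\<close>, \<open>i :: 'n\<close>, with
  \<open>n = CARD('n)\<close>, are finitely supported maps from exponents \<open>\<alpha> :: 'n \<Rightarrow>\<^sub>0 nat\<close> to coefficients.
  The ring structure is that of \<^theory>\<open>HOL-Library.Poly_Mapping\<close>; the structure of a real vector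
  space is that of \<^theory>\<open>HOL-Analysis.Finite_Function_Topology\<close>.\<close>

type_synonym 'n cpoly = "('n \<Rightarrow>\<^sub>0 nat) \<Rightarrow>\<^sub>0 complex"

definition exponents :: "nat \<Rightarrow> ('n::finite \<Rightarrow>\<^sub>0 nat) set" where
  "exponents d = {\<alpha>. (\<Sum>i\<in>UNIV. Poly_Mapping.lookup \<alpha> i) = d}"

definition hom_polys :: "nat \<Rightarrow> 'n::finite cpoly set" where
  "hom_polys d = {p. Poly_Mapping.keys p \<subseteq> exponents d}"

definition multinomial :: "nat \<Rightarrow> ('n::finite \<Rightarrow>\<^sub>0 nat) \<Rightarrow> real" where
  "multinomial d \<alpha> = fact d / (\<Prod>i\<in>UNIV. fact (Poly_Mapping.lookup \<alpha> i))"

text \<open>The normalised coefficient \<open>p\<^sub>\<alpha>\<close> in \<open>p = (\<Sum>\<alpha>. multinomial d \<alpha> * p\<^sub>\<alpha> * x\<^sup>\<alpha>)\<close>, where \<open>\<alpha>\<close> ranges over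
  \<^term>\<open>exponents d\<close>.\<close>

definition ncoeff :: "nat \<Rightarrow> 'n::finite cpoly \<Rightarrow> ('n \<Rightarrow>\<^sub>0 nat) \<Rightarrow> complex" where
  "ncoeff d p \<alpha> = Poly_Mapping.lookup p \<alpha> / complex_of_real (multinomial d \<alpha>)"

definition apolar :: "nat \<Rightarrow> 'n::finite cpoly \<Rightarrow> 'n cpoly \<Rightarrow> complex" where
  "apolar d p q =
    (\<Sum>\<alpha>\<in>exponents d. complex_of_real (multinomial d \<alpha>) * cnj (ncoeff d p \<alpha>) * ncoeff d q \<alpha>)"

definition apolar_real :: "nat \<Rightarrow> 'n::finite cpoly \<Rightarrow> 'n cpoly \<Rightarrow> real" where
  "apolar_real d p q = Re (apolar d p q)"

text \<open>The linear form \<open>v\<^sup>t x\<close>.\<close>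

definition lin_form :: "complex ^ 'n::finite \<Rightarrow> 'n cpoly" where
  "lin_form v = (\<Sum>i\<in>UNIV. Poly_Mapping.single (Poly_Mapping.single i 1) (v $ i))"

definition veronese :: "nat \<Rightarrow> 'n::finite cpoly set" where
  "veronese d = {lin_form v ^ d | v. v \<noteq> 0}"

text \<open>The tangent space at the point \<open>p\<close> of \<^term>\<open>veronese d\<close>. The vector \<open>v\<close> with
  \<open>p = (v\<^sup>t x)\<^sup>d\<close> is determined up to a \<open>d\<close>-th root of unity only, and each choice of \<open>v\<close> gives the
  same space, see \<open>veronese_tangent_eq\<close> below.\<close>

definition veronese_tangent :: "nat \<Rightarrow> 'n::finite cpoly \<Rightarrow> 'n cpoly set" where
  "veronese_tangent d p =
    {lin_form u * lin_form v ^ (d - 1) | u v. v \<noteq> 0 \<and> p = lin_form v ^ d}"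

text \<open>The Hermitian product \<open>u\<^sup>* w\<close>, antilinear in the first argument.\<close>

definition herm :: "complex ^ 'n::finite \<Rightarrow> complex ^ 'n \<Rightarrow> complex" where
  "herm u w = (\<Sum>i\<in>UNIV. cnj (u $ i) * w $ i)"

definition inner_at :: "nat \<Rightarrow> complex ^ 'n::finite \<Rightarrow> complex ^ 'n \<Rightarrow> complex ^ 'n \<Rightarrow> real" where
  "inner_at d v u w =
    Re (herm u w + (of_nat d - 1) * herm u v * herm v w / complex_of_real ((norm v)\<^sup>2))"

text \<open>The family \<open>b\<close> indexed by \<open>I\<close> is a basis of the real vector space \<open>V\<close> that is orthonormal for
  the inner product \<open>ip\<close>.\<close>

definition orthonormal_basis ::
    "('a::real_vector \<Rightarrow> 'a \<Rightarrow> real) \<Rightarrow> 'a set \<Rightarrow> 'i set \<Rightarrow> ('i \<Rightarrow> 'a) \<Rightarrow> bool" where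
  "orthonormal_basis ip V I b \<longleftrightarrow>
    inj_on b I \<and> independent (b ` I) \<and> span (b ` I) = V \<and>
    (\<forall>i\<in>I. \<forall>j\<in>I. ip (b i) (b j) = (if i = j then 1 else 0))"


subsection \<open>Well-definedness\<close>

lemma finite_exponents: "finite (exponents d :: ('n::finite \<Rightarrow>\<^sub>0 nat) set)"
proof -
  have "Poly_Mapping.lookup ` (exponents d :: ('n \<Rightarrow>\<^sub>0 nat) set) \<subseteq> Pi\<^sub>E UNIV (\<lambda>_. {..d})"
    by (auto simp: exponents_def PiE_def intro!: member_le_sum[of _ UNIV])
  moreover have "finite (Pi\<^sub>E (UNIV :: 'n set) (\<lambda>_. {..d}))"
    by (simp add: finite_PiE)
  ultimately have "finite (Poly_Mapping.lookup ` (exponents d :: ('n \<Rightarrow>\<^sub>0 nat) set))"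
    by (rule finite_subset)
  then show ?thesis
    by (rule finite_imageD) (simp add: inj_on_def poly_mapping.lookup_inject)
qed

lemma hom_polys_mult: "p \<in> hom_polys d \<Longrightarrow> q \<in> hom_polys e \<Longrightarrow> p * q \<in> hom_polys (d + e)"
  unfolding hom_polys_def exponents_def
  using keys_mult[of p q] by (fastforce simp: lookup_add sum.distrib)

lemma lin_form_hom: "lin_form v \<in> hom_polys 1"
proof -
  have "Poly_Mapping.keys (lin_form v)
      \<subseteq> (\<Union>i. Poly_Mapping.keys (Poly_Mapping.single (Poly_Mapping.single i (1::nat)) (v $ i)))"
    unfolding lin_form_def by (rule keys_sum)
  then show ?thesis
    by (fastforce simp: hom_polys_def exponents_def lookup_single when_def split: if_splits)
qed

lemma lin_form_power_hom: "lin_form v ^ d \<in> hom_polys d"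
proof (induction d)
  case 0
  show ?case by (simp add: hom_polys_def exponents_def)
next
  case (Suc d)
  then show ?case using hom_polys_mult[OF lin_form_hom[of v] Suc] by simp
qed

lemma veronese_subset: "veronese d \<subseteq> hom_polys d"
  by (auto simp: veronese_def lin_form_power_hom)

lemma veronese_tangent_subset:
  assumes "d > 0"
  shows "veronese_tangent d p \<subseteq> hom_polys d"
  using assms hom_polys_mult[OF lin_form_hom lin_form_power_hom, of _ _ "d - 1"]
  by (auto simp: veronese_tangent_def)

text \<open>Evaluation at a point is used only to compare linear forms with equal powers.\<close>

definition peval :: "complex ^ 'n::finite \<Rightarrow> 'n cpoly \<Rightarrow> complex" where
  "peval x p = (\<Sum>\<alpha>\<in>Poly_Mapping.keys p.
     Poly_Mapping.lookup p \<alpha> * (\<Prod>i\<in>UNIV. x $ i ^ Poly_Mapping.lookup \<alpha> i))"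

lemma peval_superset:
  assumes "finite S" "Poly_Mapping.keys p \<subseteq> S"
  shows "peval x p = (\<Sum>\<alpha>\<in>S. Poly_Mapping.lookup p \<alpha> * (\<Prod>i\<in>UNIV. x $ i ^ Poly_Mapping.lookup \<alpha> i))"
  unfolding peval_def using assms by (intro sum.mono_neutral_left) (auto simp: in_keys_iff)

lemma peval_add: "peval x (p + q) = peval x p + peval x q"
proof -
  let ?S = "Poly_Mapping.keys p \<union> Poly_Mapping.keys q"
  have "finite ?S" by simp
  then show ?thesis
    using peval_superset[of ?S p x] peval_superset[of ?S q x] peval_superset[of ?S "p + q" x]
      keys_add[of p q]
    by (auto simp: lookup_add algebra_simps sum.distrib)
qed

lemma peval_0: "peval x 0 = 0"
  by (simp add: peval_def)

lemma peval_sum: "peval x (\<Sum>i\<in>A. f i) = (\<Sum>i\<in>A. peval x (f i))"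
  by (induction A rule: infinite_finite_induct) (simp_all add: peval_0 peval_add)

lemma peval_single:
  "peval x (Poly_Mapping.single \<alpha> c) = c * (\<Prod>i\<in>UNIV. x $ i ^ Poly_Mapping.lookup \<alpha> i)"
  by (simp add: peval_def)

lemma sum_singles: "p = (\<Sum>\<alpha>\<in>Poly_Mapping.keys p. Poly_Mapping.single \<alpha> (Poly_Mapping.lookup p \<alpha>))"
  by (rule poly_mapping_eqI) (simp add: lookup_sum lookup_single when_def in_keys_iff)

lemma peval_mult: "peval x (p * q) = peval x p * peval x q"
proof -
  let ?s = "\<lambda>r \<alpha>. Poly_Mapping.single \<alpha> (Poly_Mapping.lookup r \<alpha>)"
  have *: "peval x (?s p \<alpha> * ?s q \<beta>) = peval x (?s p \<alpha>) * peval x (?s q \<beta>)" for \<alpha> \<beta>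
    by (simp add: mult_single peval_single lookup_add power_add prod.distrib)
  have "p * q = (\<Sum>\<alpha>\<in>Poly_Mapping.keys p. ?s p \<alpha>) * (\<Sum>\<beta>\<in>Poly_Mapping.keys q. ?s q \<beta>)"
    by (rule arg_cong2[of _ _ _ _ "(*)", OF sum_singles sum_singles])
  also have "\<dots> = (\<Sum>\<alpha>\<in>Poly_Mapping.keys p. \<Sum>\<beta>\<in>Poly_Mapping.keys q. ?s p \<alpha> * ?s q \<beta>)"
    by (rule sum_product)
  finally have "peval x (p * q)
      = (\<Sum>\<alpha>\<in>Poly_Mapping.keys p. \<Sum>\<beta>\<in>Poly_Mapping.keys q. peval x (?s p \<alpha>) * peval x (?s q \<beta>))"
    by (simp only: peval_sum *)
  also have "\<dots> = peval x p * peval x q"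
    unfolding peval_single by (simp only: peval_def sum_product)
  finally show ?thesis .
qed

lemma peval_lin_form: "peval x (lin_form v) = (\<Sum>i\<in>UNIV. v $ i * x $ i)"
proof -
  have "(\<Prod>j\<in>UNIV. x $ j ^ Poly_Mapping.lookup (Poly_Mapping.single i (1::nat)) j) = x $ i" for i
  proof -
    have "(\<Prod>j\<in>UNIV. x $ j ^ Poly_Mapping.lookup (Poly_Mapping.single i (1::nat)) j)
        = (\<Prod>j\<in>UNIV. if j = i then x $ j else 1)"
      by (rule prod.cong) (auto simp: lookup_single when_def)
    then show ?thesis by simp
  qed
  then show ?thesis by (simp add: lin_form_def peval_sum peval_single)
qed

lemma peval_power: "peval x (p ^ k) = peval x p ^ k"
proof (induction k)
  case 0
  show ?case by (simp add: peval_def)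
qed (simp add: peval_mult)

lemma lin_form_scale:
  "lin_form (\<chi> i. c * v $ i) = Poly_Mapping.single 0 c * lin_form v"
  by (simp add: lin_form_def sum_distrib_left mult_single)

lemma lin_form_power_eqD:
  assumes "lin_form v ^ d = lin_form w ^ d" "v \<noteq> 0" "d > 0"
  obtains c where "w = (\<chi> i. c * v $ i)"
proof -
  obtain i where i: "v $ i \<noteq> 0" using \<open>v \<noteq> 0\<close> by (auto simp: vec_eq_iff)
  have zero: "(\<Sum>k\<in>UNIV. w $ k * x $ k) = 0" if "(\<Sum>k\<in>UNIV. v $ k * x $ k) = 0" for x :: "complex ^ 'a"
    using arg_cong[OF assms(1), of "peval x"] that \<open>d > 0\<close>
    by (simp add: peval_power peval_lin_form zero_power)
  have "w $ j * v $ i = w $ i * v $ j" for j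
  proof -
    define x where "x = axis j (v $ i) - axis i (v $ j)"
    have "(\<Sum>k\<in>UNIV. a $ k * x $ k) = a $ j * v $ i - a $ i * v $ j" for a :: "complex ^ 'a"
      by (simp add: x_def axis_def right_diff_distrib sum_subtractf if_distrib[of "\<lambda>t. a $ _ * t"] cong: if_cong)
    then show ?thesis using zero[of x] by simp
  qed
  then have "w = (\<chi> j. (w $ i / v $ i) * v $ j)"
    using i by (simp add: vec_eq_iff field_simps)
  then show ?thesis using that by blast
qed

lemma veronese_tangent_eq:
  assumes "d > 0" "v \<noteq> 0"
  shows "veronese_tangent d (lin_form v ^ d) = {lin_form u * lin_form v ^ (d - 1) | u. True}"
proof -
  have "\<exists>u'. lin_form u * lin_form w ^ (d - 1) = lin_form u' * lin_form v ^ (d - 1)"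
    if eq: "lin_form v ^ d = lin_form w ^ d" for u w
  proof -
    obtain c where "w = (\<chi> i. c * v $ i)"
      using lin_form_power_eqD[OF eq assms(2,1)] .
    then have w: "lin_form w = Poly_Mapping.single 0 c * lin_form v"
      by (simp only: lin_form_scale)
    have pow: "Poly_Mapping.single 0 c ^ k = (Poly_Mapping.single 0 (c ^ k) :: 'a cpoly)" for k
      by (induction k) (simp_all add: mult_single)
    have "lin_form u * lin_form w ^ (d - 1)
        = (Poly_Mapping.single 0 (c ^ (d - 1)) * lin_form u) * lin_form v ^ (d - 1)"
      unfolding w power_mult_distrib pow by (simp only: mult_ac)
    then have "lin_form u * lin_form w ^ (d - 1)
        = lin_form (\<chi> i. c ^ (d - 1) * u $ i) * lin_form v ^ (d - 1)"
      unfolding lin_form_scale .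
    then show ?thesis by blast
  qed
  then show ?thesis using assms unfolding veronese_tangent_def by blast
qed

end

theory Submission
  imports Defs
begin

text \<open>The tangent space at \<open>(v\<^sup>t x)\<^sup>d\<close> is the image of the real-linear map
  \<open>a \<mapsto> c \<cdot> (a\<^sup>t x) (v\<^sup>t x)\<^sup>d\<^sup>-\<^sup>1\<close> with \<open>c = \<surd>d \<cdot> \<parallel>v\<parallel>\<^sup>1\<^sup>-\<^sup>d\<close>, and the inner product at \<open>v\<close> is exactly
  the real apolar product pulled back along this map (\<open>tangent_map_isometry\<close>). The inner
  product at \<open>v\<close> dominates the Euclidean one, so an isometry out of it is injective. An injective
  linear isometry carries orthonormal bases to orthonormal bases of its image, and the \<open>q\<^sub>i\<close> are
  the images of the \<open>u\<^sub>i\<close>.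

  The pull-back formula amounts to
  \[d \cdot \langle (a^t x)(v^t x)^{d-1}, (b^t x)(v^t x)^{d-1} \rangle_d
    = (a^* b)\|v\|^{2d-2} + (d-1)(a^* v)(v^* b)\|v\|^{2d-4}.\]
  It rests on the fact that, up to the factor \<open>d\<close>, multiplication by a linear form \<open>a\<^sup>t x\<close> is adjoint
  to differentiation in the direction of the conjugate of \<open>a\<close> (\<open>apolar_lin_form_mult_left\<close>).
  Products of powers of linear forms are then evaluated by moving the linear factors of the left
  argument to the right one at a time and applying the Leibniz rule.\<close>

section \<open>Multiplication by a variable and partial differentiation\<close>

lemma lookup_single_mult:
  fixes c :: complex and f :: "'n::finite cpoly"
  shows "Poly_Mapping.lookup (Poly_Mapping.single m c * f) \<alpha>
    = (\<Sum>\<gamma>\<in>Poly_Mapping.keys f. if m + \<gamma> = \<alpha> then c * Poly_Mapping.lookup f \<gamma> else 0)"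
proof -
  have "Poly_Mapping.single m c * f = (\<Sum>\<gamma>\<in>Poly_Mapping.keys f.
      Poly_Mapping.single (m + \<gamma>) (c * Poly_Mapping.lookup f \<gamma>))"
    by (subst (1) sum_singles[of f]) (simp add: sum_distrib_left mult_single)
  then show ?thesis
    by (simp add: lookup_sum lookup_single when_def)
qed

lemma lookup_const_mult:
  fixes f :: "'n::finite cpoly"
  shows "Poly_Mapping.lookup (Poly_Mapping.single 0 c * f) \<alpha> = c * Poly_Mapping.lookup f \<alpha>"
  by (auto simp: lookup_single_mult in_keys_iff)

lemma minus_plus_single:
  fixes \<alpha> :: "'n \<Rightarrow>\<^sub>0 nat"
  assumes "Poly_Mapping.lookup \<alpha> i \<noteq> 0"
  shows "\<alpha> - Poly_Mapping.single i 1 + Poly_Mapping.single i 1 = \<alpha>"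
  using assms
  by (intro poly_mapping_eqI) (auto simp: lookup_add lookup_minus lookup_single when_def)

lemma lookup_single_var_mult:
  fixes f :: "'n::finite cpoly"
  shows "Poly_Mapping.lookup (Poly_Mapping.single (Poly_Mapping.single i 1) c * f) \<alpha>
    = (if Poly_Mapping.lookup \<alpha> i = 0 then 0
       else c * Poly_Mapping.lookup f (\<alpha> - Poly_Mapping.single i 1))"
proof (cases "Poly_Mapping.lookup \<alpha> i = 0")
  case True
  then have "Poly_Mapping.single i 1 + \<gamma> \<noteq> \<alpha>" for \<gamma>
    by (auto simp: lookup_add)
  then show ?thesis
    using True by (simp add: lookup_single_mult)
next
  case False
  then have "Poly_Mapping.single i 1 + \<gamma> = \<alpha> \<longleftrightarrow> \<gamma> = \<alpha> - Poly_Mapping.single i 1" for \<gamma>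
    using minus_plus_single[OF False] by (metis add.commute add_diff_cancel_left')
  then show ?thesis
    using False by (auto simp: lookup_single_mult in_keys_iff)
qed

text \<open>A monomial without \<open>x\<^sub>i\<close> gets the coefficient \<open>0\<close> below, which makes the truncated
  subtraction in its exponent harmless.\<close>

definition partial_deriv :: "'n \<Rightarrow> 'n::finite cpoly \<Rightarrow> 'n cpoly" where
  "partial_deriv i g = (\<Sum>\<gamma>\<in>Poly_Mapping.keys g.
     Poly_Mapping.single (\<gamma> - Poly_Mapping.single i 1)
       (of_nat (Poly_Mapping.lookup \<gamma> i) * Poly_Mapping.lookup g \<gamma>))"

lemma lookup_partial_deriv:
  "Poly_Mapping.lookup (partial_deriv i g) \<beta>
    = of_nat (Suc (Poly_Mapping.lookup \<beta> i)) * Poly_Mapping.lookup g (\<beta> + Poly_Mapping.single i 1)"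
proof -
  have "(of_nat (Poly_Mapping.lookup \<gamma> i) * Poly_Mapping.lookup g \<gamma> when \<gamma> - Poly_Mapping.single i 1 = \<beta>)
      = (if \<gamma> = \<beta> + Poly_Mapping.single i 1
         then of_nat (Poly_Mapping.lookup \<gamma> i) * Poly_Mapping.lookup g \<gamma> else 0)" for \<gamma>
    using minus_plus_single[of \<gamma> i] by (cases "Poly_Mapping.lookup \<gamma> i = 0") (auto simp: when_def lookup_add)
  then show ?thesis
    by (auto simp: partial_deriv_def lookup_sum lookup_single in_keys_iff lookup_add)
qed

lemma partial_deriv_add: "partial_deriv i (f + g) = partial_deriv i f + partial_deriv i g"
  by (rule poly_mapping_eqI) (simp add: lookup_partial_deriv lookup_add algebra_simps)

lemma partial_deriv_0: "partial_deriv i 0 = 0"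
  by (simp add: partial_deriv_def)

lemma partial_deriv_sum: "partial_deriv i (\<Sum>j\<in>A. f j) = (\<Sum>j\<in>A. partial_deriv i (f j))"
  by (induction A rule: infinite_finite_induct) (simp_all add: partial_deriv_0 partial_deriv_add)

text \<open>The Leibniz rule when one factor is a multiple of a variable. Both sides are linear in the
  first factor, so this case gives the rule for every linear form.\<close>

lemma partial_deriv_var_mult:
  "partial_deriv j (Poly_Mapping.single (Poly_Mapping.single i 1) c * f)
    = (if i = j then Poly_Mapping.single 0 c * f else 0)
      + Poly_Mapping.single (Poly_Mapping.single i 1) c * partial_deriv j f"
proof (rule poly_mapping_eqI)
  fix \<beta> :: "'a \<Rightarrow>\<^sub>0 nat"
  let ?e = "\<lambda>i. Poly_Mapping.single i (1::nat)"
  show "Poly_Mapping.lookup (partial_deriv j (Poly_Mapping.single (?e i) c * f)) \<beta>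
    = Poly_Mapping.lookup ((if i = j then Poly_Mapping.single 0 c * f else 0)
      + Poly_Mapping.single (?e i) c * partial_deriv j f) \<beta>"
  proof (cases "Poly_Mapping.lookup \<beta> i = 0")
    case True
    \<comment> \<open>If \<open>x\<^sub>i\<close> does not occur in \<open>x\<^sup>\<beta>\<close>, only the first summand can contribute, and only for \<open>i = j\<close>.\<close>
    then show ?thesis
      unfolding lookup_partial_deriv lookup_single_var_mult lookup_add
      by (auto simp: lookup_single lookup_const_mult when_def)
  next
    case False
    have shift: "\<beta> + ?e j - ?e i = \<beta> - ?e i + ?e j"
      using False by (intro poly_mapping_eqI) (auto simp: lookup_add lookup_minus lookup_single when_def)
    have "\<beta> - ?e i + ?e i = \<beta>"
      using minus_plus_single[OF False] .
    then show ?thesis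
      using False unfolding lookup_partial_deriv lookup_single_var_mult lookup_add shift
      by (auto simp: lookup_single lookup_const_mult lookup_minus when_def distrib_right distrib_left)
         (simp add: algebra_simps)
  qed
qed

text \<open>The derivative in the direction of the conjugate of \<open>a\<close>: the conjugation is the one in the left
  argument of the apolar product, so that this operator is the adjoint of multiplication by \<open>a\<^sup>t x\<close>.\<close>

definition dir_deriv :: "complex ^ 'n::finite \<Rightarrow> 'n cpoly \<Rightarrow> 'n cpoly" where
  "dir_deriv a g = (\<Sum>i\<in>UNIV. Poly_Mapping.single 0 (cnj (a $ i)) * partial_deriv i g)"

text \<open>The derivative of \<open>w\<^sup>t x\<close> is the constant \<open>a\<^sup>* w\<close>; this is how the Hermitian product
  arises from the apolar one.\<close>

lemma dir_deriv_lin_form_mult: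
  "dir_deriv a (lin_form w * g) = Poly_Mapping.single 0 (herm a w) * g + lin_form w * dir_deriv a g"
proof -
  let ?C = "\<lambda>c. Poly_Mapping.single (0 :: 'a \<Rightarrow>\<^sub>0 nat) (c :: complex)"
  have "partial_deriv j (lin_form w * g) = ?C (w $ j) * g + lin_form w * partial_deriv j g" for j
    by (simp add: lin_form_def sum_distrib_right partial_deriv_sum partial_deriv_var_mult[simplified]
        sum.distrib)
  moreover have "?C (herm a w) = (\<Sum>j\<in>UNIV. ?C (cnj (a $ j)) * ?C (w $ j))"
    unfolding herm_def
    by (rule poly_mapping_eqI) (simp add: lookup_sum mult_single lookup_single when_def)
  ultimately show ?thesis
    by (simp add: dir_deriv_def distrib_left sum.distrib sum_distrib_left sum_distrib_right mult_ac)
qed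

lemma dir_deriv_1: "dir_deriv a 1 = 0"
proof -
  have "partial_deriv i 1 = 0" for i :: 'a
    by (rule poly_mapping_eqI)
       (auto simp: lookup_partial_deriv lookup_one when_def lookup_add dest: arg_cong[where f = "\<lambda>m. Poly_Mapping.lookup m i"])
  then show ?thesis
    by (simp add: dir_deriv_def)
qed

lemma dir_deriv_lin_form_power:
  "dir_deriv a (lin_form w ^ k) = Poly_Mapping.single 0 (of_nat k * herm a w) * lin_form w ^ (k - 1)"
proof (induction k)
  case 0
  show ?case by (simp add: dir_deriv_1)
next
  case (Suc k)
  have "lin_form w * (Poly_Mapping.single 0 (of_nat k * herm a w) * lin_form w ^ (k - 1))
      = Poly_Mapping.single 0 (of_nat k * herm a w) * lin_form w ^ k"
    by (cases k) (simp_all add: mult_ac)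
  then have "dir_deriv a (lin_form w ^ Suc k)
      = (Poly_Mapping.single 0 (herm a w) + Poly_Mapping.single 0 (of_nat k * herm a w)) * lin_form w ^ k"
    by (simp add: dir_deriv_lin_form_mult Suc.IH distrib_right)
  then show ?case
    by (simp add: single_add[symmetric] algebra_simps)
qed

section \<open>The apolar product\<close>

lemma multinomial_pos: "multinomial d \<alpha> > 0"
  by (simp add: multinomial_def prod_pos)

lemma apolar_eq_sum:
  "apolar d p q = (\<Sum>\<alpha>\<in>exponents d.
     cnj (Poly_Mapping.lookup p \<alpha>) * Poly_Mapping.lookup q \<alpha> / of_real (multinomial d \<alpha>))"
  unfolding apolar_def ncoeff_def
  using multinomial_pos[of d] by (intro sum.cong) (auto simp: less_le)

lemma apolar_add_left: "apolar d (p + p') q = apolar d p q + apolar d p' q"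
  by (simp add: apolar_eq_sum lookup_add algebra_simps add_divide_distrib sum.distrib)

lemma apolar_add_right: "apolar d p (q + q') = apolar d p q + apolar d p q'"
  by (simp add: apolar_eq_sum lookup_add algebra_simps add_divide_distrib sum.distrib)

lemma apolar_0_left: "apolar d 0 q = 0"
  by (simp add: apolar_eq_sum)

lemma apolar_0_right: "apolar d p 0 = 0"
  by (simp add: apolar_eq_sum)

lemma apolar_sum_left: "apolar d (\<Sum>i\<in>A. f i) q = (\<Sum>i\<in>A. apolar d (f i) q)"
  by (induction A rule: infinite_finite_induct) (simp_all add: apolar_0_left apolar_add_left)

lemma apolar_sum_right: "apolar d p (\<Sum>i\<in>A. f i) = (\<Sum>i\<in>A. apolar d p (f i))"
  by (induction A rule: infinite_finite_induct) (simp_all add: apolar_0_right apolar_add_right)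

lemma apolar_const_mult_left: "apolar d (Poly_Mapping.single 0 c * p) q = cnj c * apolar d p q"
  unfolding apolar_eq_sum lookup_const_mult by (simp add: sum_distrib_left mult_ac)

lemma apolar_const_mult_right: "apolar d p (Poly_Mapping.single 0 c * q) = c * apolar d p q"
  unfolding apolar_eq_sum lookup_const_mult by (simp add: sum_distrib_left mult_ac)

text \<open>The apolar product weights a monomial by its inverse multinomial coefficient. Multiplying
  \<open>x\<^sup>\<beta>\<close> by \<open>x\<^sub>i\<close> changes this weight by \<open>(\<beta>\<^sub>i + 1) / (d + 1)\<close>, and \<open>\<beta>\<^sub>i + 1\<close> is the factor that
  differentiating \<open>x\<^sup>\<beta> \<cdot> x\<^sub>i\<close> with respect to \<open>x\<^sub>i\<close> produces. This is the reason why multiplication and differentiation are adjoint.\<close>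

lemma multinomial_Suc:
  "multinomial (Suc d) (\<beta> + Poly_Mapping.single i 1) * real (Suc (Poly_Mapping.lookup \<beta> i))
    = real (Suc d) * multinomial d \<beta>"
proof -
  let ?b = "Poly_Mapping.lookup \<beta>"
  have "(\<Prod>j\<in>UNIV. fact (Poly_Mapping.lookup (\<beta> + Poly_Mapping.single i 1) j))
      = (\<Prod>j\<in>UNIV. fact (?b j) * (if j = i then real (Suc (?b i)) else 1))"
    by (rule prod.cong) (auto simp: lookup_add lookup_single when_def algebra_simps)
  also have "\<dots> = (\<Prod>j\<in>UNIV. fact (?b j)) * real (Suc (?b i))"
    by (simp add: prod.distrib)
  finally show ?thesis
    by (simp add: multinomial_def del: of_nat_Suc)
qed

text \<open>The exponents of \<open>x\<^sub>i f\<close> are those of \<open>f\<close> shifted by one in the \<open>i\<close>-th place. Reindexing the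
  sum along this shift turns the weight of degree \<open>d + 1\<close> into that of degree \<open>d\<close> times the
  factor of differentiation.\<close>

lemma apolar_var_mult_left:
  "of_nat (Suc d) * apolar (Suc d) (Poly_Mapping.single (Poly_Mapping.single i 1) c * f) g
    = cnj c * apolar d f (partial_deriv i g)"
proof -
  let ?e = "Poly_Mapping.single i (1::nat)"
  let ?t = "\<lambda>\<alpha>. cnj (Poly_Mapping.lookup (Poly_Mapping.single ?e c * f) \<alpha>)
    * Poly_Mapping.lookup g \<alpha> / of_real (multinomial (Suc d) \<alpha>)"
  have inj: "inj_on (\<lambda>\<beta>. \<beta> + ?e) (exponents d)"
    by (simp add: inj_on_def)
  have shift_degree: "(\<Sum>j\<in>UNIV. Poly_Mapping.lookup (\<beta> + ?e) j)
      = Suc (\<Sum>j\<in>UNIV. Poly_Mapping.lookup \<beta> j)" for \<beta>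
    by (simp add: lookup_add sum.distrib lookup_single when_def)
  have sub: "(\<lambda>\<beta>. \<beta> + ?e) ` exponents d \<subseteq> exponents (Suc d)"
    using shift_degree by (auto simp: exponents_def)
  have outside: "?t \<alpha> = 0" if "\<alpha> \<in> exponents (Suc d) - (\<lambda>\<beta>. \<beta> + ?e) ` exponents d" for \<alpha>
  proof -
    have "Poly_Mapping.lookup \<alpha> i = 0"
    proof (rule ccontr)
      assume "Poly_Mapping.lookup \<alpha> i \<noteq> 0"
      then have *: "\<alpha> - ?e + ?e = \<alpha>"
        by (rule minus_plus_single)
      have "\<alpha> - ?e \<in> exponents d"
        using that shift_degree[of "\<alpha> - ?e"] unfolding * by (simp add: exponents_def)
      then show False
        using that * by (metis DiffE image_eqI)
    qed
    then show ?thesis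
      unfolding lookup_single_var_mult by simp
  qed
  have "apolar (Suc d) (Poly_Mapping.single ?e c * f) g = (\<Sum>\<alpha>\<in>(\<lambda>\<beta>. \<beta> + ?e) ` exponents d. ?t \<alpha>)"
    unfolding apolar_eq_sum
    using sub outside by (intro sum.mono_neutral_right finite_exponents) auto
  also have "\<dots> = (\<Sum>\<beta>\<in>exponents d. ?t (\<beta> + ?e))"
    by (simp only: sum.reindex[OF inj] o_def)
  finally have "of_nat (Suc d) * apolar (Suc d) (Poly_Mapping.single ?e c * f) g
      = (\<Sum>\<beta>\<in>exponents d. of_nat (Suc d) * ?t (\<beta> + ?e))"
    by (simp only: sum_distrib_left)
  also have "\<dots> = (\<Sum>\<beta>\<in>exponents d. cnj c * (cnj (Poly_Mapping.lookup f \<beta>)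
      * Poly_Mapping.lookup (partial_deriv i g) \<beta> / of_real (multinomial d \<beta>)))"
  proof (rule sum.cong[OF refl])
    fix \<beta> :: "'a \<Rightarrow>\<^sub>0 nat"
    let ?M = "complex_of_real (multinomial (Suc d) (\<beta> + ?e))" and ?N = "complex_of_real (multinomial d \<beta>)"
    have nz: "?M \<noteq> 0" "?N \<noteq> 0"
      using multinomial_pos[of "Suc d" "\<beta> + ?e"] multinomial_pos[of d \<beta>] by auto
    have rel: "?M * of_nat (Suc (Poly_Mapping.lookup \<beta> i)) = of_nat (Suc d) * ?N"
      using arg_cong[OF multinomial_Suc[of d \<beta> i], of complex_of_real]
      by (simp only: of_real_mult of_real_of_nat_eq)
    have "Poly_Mapping.lookup (Poly_Mapping.single ?e c * f) (\<beta> + ?e) = c * Poly_Mapping.lookup f \<beta>"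
      unfolding lookup_single_var_mult by (simp add: lookup_add)
    moreover have "of_nat (Suc d) / ?M = of_nat (Suc (Poly_Mapping.lookup \<beta> i)) / ?N"
      using nz rel by (simp add: frac_eq_eq mult.commute del: of_nat_Suc)
    moreover have "of_nat (Suc d) * (x * y / ?M) = of_nat (Suc d) / ?M * (x * y)" for x y
      by simp
    ultimately show "of_nat (Suc d) * ?t (\<beta> + ?e) = cnj c * (cnj (Poly_Mapping.lookup f \<beta>)
        * Poly_Mapping.lookup (partial_deriv i g) \<beta> / ?N)"
      by (simp only: lookup_partial_deriv) (simp add: mult_ac del: of_nat_Suc)
  qed
  finally show ?thesis
    by (simp add: apolar_eq_sum sum_distrib_left)
qed

lemma apolar_lin_form_mult_left:
  "of_nat (Suc d) * apolar (Suc d) (lin_form a * f) g = apolar d f (dir_deriv a g)"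
proof -
  have "of_nat (Suc d) * apolar (Suc d) (lin_form a * f) g
      = (\<Sum>i\<in>UNIV. of_nat (Suc d)
          * apolar (Suc d) (Poly_Mapping.single (Poly_Mapping.single i 1) (a $ i) * f) g)"
    by (simp only: lin_form_def sum_distrib_right apolar_sum_left sum_distrib_left)
  also have "\<dots> = apolar d f (dir_deriv a g)"
    by (simp only: apolar_var_mult_left dir_deriv_def apolar_sum_right apolar_const_mult_right)
  finally show ?thesis .
qed

text \<open>The powers \<open>(v\<^sup>t x)\<^sup>d\<close> act as reproducing kernels for the apolar product: one adjunction
  step lowers both degrees by one and produces one factor \<open>v\<^sup>* w\<close>.\<close>

lemma apolar_lin_form_powers: "apolar d (lin_form v ^ d) (lin_form w ^ d) = herm v w ^ d"
proof (induction d)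
  case 0
  have "exponents 0 = {0 :: 'a \<Rightarrow>\<^sub>0 nat}"
    by (auto simp: exponents_def intro: poly_mapping_eqI)
  then show ?case
    by (simp add: apolar_eq_sum multinomial_def lookup_one)
next
  case (Suc d)
  have "of_nat (Suc d) * apolar (Suc d) (lin_form v ^ Suc d) (lin_form w ^ Suc d)
      = of_nat (Suc d) * herm v w ^ Suc d"
    by (simp only: power_Suc[of "lin_form v"] apolar_lin_form_mult_left dir_deriv_lin_form_power
        apolar_const_mult_right diff_Suc_1 Suc.IH) simp
  then show ?case
    by (simp del: of_nat_Suc power_Suc)
qed

text \<open>One adjunction step again. In the Leibniz rule, the term that differentiates \<open>w\<^sup>t x\<close>
  leaves two pure powers, and those that differentiate a factor \<open>y\<^sup>t x\<close> fall under the
  induction hypothesis. Since all factors on the left agree, all \<open>k + 1\<close> terms have the same value.\<close>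

lemma apolar_power_tangent:
  "apolar (Suc k) (lin_form v ^ Suc k) (lin_form w * lin_form y ^ k) = herm v w * herm v y ^ k"
proof (induction k)
  case 0
  show ?case
    using apolar_lin_form_powers[of 1 v w] by simp
next
  case (Suc k)
  have "of_nat (Suc (Suc k)) * apolar (Suc (Suc k)) (lin_form v ^ Suc (Suc k)) (lin_form w * lin_form y ^ Suc k)
      = apolar (Suc k) (lin_form v ^ Suc k)
          (Poly_Mapping.single 0 (herm v w) * lin_form y ^ Suc k
           + Poly_Mapping.single 0 (of_nat (Suc k) * herm v y) * (lin_form w * lin_form y ^ k))"
    by (simp only: power_Suc[of "lin_form v" "Suc k"] apolar_lin_form_mult_left dir_deriv_lin_form_mult
        dir_deriv_lin_form_power diff_Suc_1 mult.left_commute[of "lin_form w"])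
  also have "\<dots> = herm v w * herm v y ^ Suc k + of_nat (Suc k) * herm v y * (herm v w * herm v y ^ k)"
    by (simp only: apolar_add_right apolar_const_mult_right apolar_lin_form_powers Suc.IH)
  also have "\<dots> = of_nat (Suc (Suc k)) * (herm v w * herm v y ^ Suc k)"
    by (simp add: algebra_simps)
  finally show ?case
    by (simp del: of_nat_Suc power_Suc)
qed

text \<open>One adjunction step on the factor \<open>a\<^sup>t x\<close>: it differentiates either the factor \<open>w\<^sup>t x\<close>,
  giving the first summand, or one of the \<open>k\<close> factors \<open>y\<^sup>t x\<close>, giving the second.\<close>

lemma apolar_tangent_vectors:
  "of_nat (Suc k) * apolar (Suc k) (lin_form a * lin_form v ^ k) (lin_form w * lin_form y ^ k)
    = herm a w * herm v y ^ k + of_nat k * herm a y * herm v w * herm v y ^ (k - 1)"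
proof (cases k)
  case 0
  then show ?thesis
    using apolar_lin_form_powers[of 1 a w] by simp
next
  case (Suc m)
  have "of_nat (Suc k) * apolar (Suc k) (lin_form a * lin_form v ^ k) (lin_form w * lin_form y ^ k)
      = apolar k (lin_form v ^ k)
          (Poly_Mapping.single 0 (herm a w) * lin_form y ^ k
           + Poly_Mapping.single 0 (of_nat k * herm a y) * (lin_form w * lin_form y ^ (k - 1)))"
    by (simp only: apolar_lin_form_mult_left dir_deriv_lin_form_mult
        dir_deriv_lin_form_power mult.left_commute[of "lin_form w"])
  also have "\<dots> = herm a w * herm v y ^ k + of_nat k * herm a y * (herm v w * herm v y ^ (k - 1))"
    unfolding Suc
    by (simp only: apolar_add_right apolar_const_mult_right apolar_lin_form_powers
        apolar_power_tangent diff_Suc_1)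
  finally show ?thesis
    by (simp add: mult_ac)
qed

section \<open>The tangent space as an isometric image\<close>

lemma herm_self: "herm v v = complex_of_real ((norm v)\<^sup>2)"
proof -
  have "(norm v)\<^sup>2 = (\<Sum>i\<in>UNIV. (norm (v $ i))\<^sup>2)"
    by (simp add: norm_vec_def L2_set_def sum_nonneg)
  then show ?thesis
    by (simp add: herm_def complex_norm_square mult.commute del: of_real_power)
qed

lemma herm_commute: "herm v a = cnj (herm a v)"
  by (simp add: herm_def mult.commute)

text \<open>The correction term in the inner product at \<open>v\<close> is the nonnegative number
  \<open>(d - 1) \<bar>a\<^sup>* v\<bar>\<^sup>2 / \<parallel>v\<parallel>\<^sup>2\<close>; hence the inner product is positive definite.\<close>

lemma norm_le_inner_at:
  assumes "d > 0"
  shows "(norm a)\<^sup>2 \<le> inner_at d v a a"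
proof -
  have "(of_nat d - 1) * herm a v * herm v a / complex_of_real ((norm v)\<^sup>2)
      = complex_of_real (real (d - 1) * (norm (herm a v))\<^sup>2 / (norm v)\<^sup>2)"
    using assms complex_norm_square[of "herm a v"] by (simp add: herm_commute[of v a] of_nat_diff mult.assoc)
  then have "inner_at d v a a = (norm a)\<^sup>2 + real (d - 1) * (norm (herm a v))\<^sup>2 / (norm v)\<^sup>2"
    by (simp only: inner_at_def herm_self of_real_add[symmetric] Re_complex_of_real)
  then show ?thesis
    by simp
qed

lemma scaleR_eq_const_mult:
  fixes p :: "'n::finite cpoly"
  shows "r *\<^sub>R p = Poly_Mapping.single 0 (complex_of_real r) * p"
proof (rule poly_mapping_eqI)
  fix \<alpha>
  have "finite {\<alpha>. r *\<^sub>R Poly_Mapping.lookup p \<alpha> \<noteq> 0}"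
    by (rule finite_subset[OF _ finite_keys[of p]]) (auto simp: in_keys_iff)
  then show "Poly_Mapping.lookup (r *\<^sub>R p) \<alpha>
      = Poly_Mapping.lookup (Poly_Mapping.single 0 (complex_of_real r) * p) \<alpha>"
    by (simp add: scaleR_poly_mapping_def lookup_const_mult scaleR_conv_of_real)
qed

lemma lin_form_add: "lin_form (a + b) = lin_form a + lin_form b"
  by (simp add: lin_form_def single_add sum.distrib)

lemma lin_form_scaleR: "lin_form (r *\<^sub>R a) = r *\<^sub>R lin_form a"
proof -
  have "r *\<^sub>R a = (\<chi> i. complex_of_real r * a $ i)"
    by (simp add: vec_eq_iff scaleR_conv_of_real[where 'a = complex])
  then show ?thesis
    by (simp add: lin_form_scale scaleR_eq_const_mult)
qed

definition tangent_map :: "nat \<Rightarrow> complex ^ 'n::finite \<Rightarrow> complex ^ 'n \<Rightarrow> 'n cpoly" where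
  "tangent_map d v a = (sqrt (real d) * norm v powi (- int d + 1)) *\<^sub>R (lin_form a * lin_form v ^ (d - 1))"

lemma linear_tangent_map: "linear (tangent_map d v)"
  by (rule linearI)
     (simp_all add: tangent_map_def lin_form_add lin_form_scaleR scaleR_eq_const_mult algebra_simps)

text \<open>With \<open>N = \<parallel>v\<parallel>\<^sup>2 = v\<^sup>* v\<close>, the square of the scaling factor is \<open>d / N\<^sup>d\<^sup>-\<^sup>1\<close>. It cancels the factor \<open>d\<close> of
  the adjunction and the power of \<open>N\<close> in the first summand of \<open>apolar_tangent_vectors\<close>, and
  leaves \<open>1 / N\<close> in the second.\<close>

lemma tangent_map_isometry:
  assumes "d > 1" "v \<noteq> 0"
  shows "apolar_real d (tangent_map d v a) (tangent_map d v b) = inner_at d v a b"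
proof -
  obtain m where d: "d = Suc (Suc m)"
    using less_imp_Suc_add[OF assms(1)] by auto
  define N where "N = (norm v)\<^sup>2"
  have N: "N > 0"
    using assms(2) by (simp add: N_def)
  define c where "c = sqrt (real d) * norm v powi (- int d + 1)"
  have "- int d + 1 = - int (Suc m)"
    by (simp add: d)
  then have "norm v powi (- int d + 1) = inverse (norm v ^ Suc m)"
    by (simp only: power_int_minus power_int_of_nat)
  then have "c\<^sup>2 = real d * inverse ((norm v ^ Suc m)\<^sup>2)"
    by (simp only: c_def power_mult_distrib power_inverse real_sqrt_pow2 of_nat_0_le_iff)
  also have "(norm v ^ Suc m)\<^sup>2 = N ^ Suc m"
    unfolding N_def by (simp only: mult.commute flip: power_mult)
  finally have "c\<^sup>2 = real d / N ^ Suc m"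
    by (simp only: divide_inverse)
  then have c: "complex_of_real c * complex_of_real c = of_nat d / of_real N ^ Suc m"
    by (metis of_real_divide of_real_mult of_real_of_nat_eq of_real_power power2_eq_square)
  have "apolar d (tangent_map d v a) (tangent_map d v b)
      = (complex_of_real c * complex_of_real c)
        * apolar d (lin_form a * lin_form v ^ Suc m) (lin_form b * lin_form v ^ Suc m)"
    unfolding tangent_map_def c_def[symmetric] scaleR_eq_const_mult apolar_const_mult_left
      apolar_const_mult_right
    by (simp add: d)
  also have "\<dots> = (of_nat d * apolar d (lin_form a * lin_form v ^ Suc m) (lin_form b * lin_form v ^ Suc m))
      / of_real N ^ Suc m"
    unfolding c by simp
  also have "\<dots> = (herm a b * of_real N ^ Suc m + of_nat (Suc m) * herm a v * herm v b * of_real N ^ m)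
      / of_real N ^ Suc m"
    unfolding d apolar_tangent_vectors herm_self N_def[symmetric] by simp
  also have "\<dots> = herm a b + (of_nat d - 1) * herm a v * herm v b / of_real N"
    using N by (simp add: d field_simps)
  finally show ?thesis
    by (simp add: apolar_real_def inner_at_def N_def)
qed

text \<open>The scaling factor is real and nonzero, so it can be absorbed into the linear form.\<close>

lemma range_tangent_map:
  assumes "d > 0" "v \<noteq> 0"
  shows "range (tangent_map d v) = veronese_tangent d (lin_form v ^ d)"
proof -
  define c where "c = sqrt (real d) * norm v powi (- int d + 1)"
  have "c \<noteq> 0"
    using assms by (simp add: c_def)
  have scaled: "tangent_map d v a = c *\<^sub>R (lin_form a * lin_form v ^ (d - 1))" for a
    by (simp only: tangent_map_def c_def)
  have "lin_form a * lin_form v ^ (d - 1) = tangent_map d v ((1 / c) *\<^sub>R a)" for a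
    using \<open>c \<noteq> 0\<close> by (simp add: linear_scale[OF linear_tangent_map] scaled)
  moreover have "tangent_map d v a = lin_form (c *\<^sub>R a) * lin_form v ^ (d - 1)" for a
    by (simp add: scaled lin_form_scaleR scaleR_eq_const_mult mult_ac)
  ultimately show ?thesis
    unfolding veronese_tangent_eq[OF assms] by blast
qed

lemma orthonormal_basis_linear_image:
  assumes "orthonormal_basis ip UNIV I b" "linear f" "inj f"
    and "\<And>x y. ip' (f x) (f y) = ip x y"
  shows "orthonormal_basis ip' (range f) I (\<lambda>i. f (b i))"
proof -
  have "inj_on b I" "independent (b ` I)" "span (b ` I) = UNIV"
    and "\<forall>i\<in>I. \<forall>j\<in>I. ip (b i) (b j) = (if i = j then 1 else 0)"
    using assms(1) by (simp_all add: orthonormal_basis_def)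
  moreover have "(\<lambda>i. f (b i)) ` I = f ` b ` I"
    by auto
  moreover have "independent (f ` b ` I)"
    using \<open>independent (b ` I)\<close> linear_independent_injective_image[OF assms(2)] assms(3) inj_on_subset by blast
  moreover have "span (f ` b ` I) = range f"
    using linear_span_image[OF assms(2)] \<open>span (b ` I) = UNIV\<close> by metis
  ultimately show ?thesis
    using assms(3,4) by (simp add: orthonormal_basis_def inj_on_def)
qed

lemma orthonormal_basis_cong:
  assumes "\<And>i. i \<in> I \<Longrightarrow> b i = b' i"
  shows "orthonormal_basis ip V I b = orthonormal_basis ip V I b'"
  using assms by (simp add: orthonormal_basis_def cong: inj_on_cong image_cong)

theorem lemma4p7:
  fixes d :: nat
    and v :: "complex ^ 'n::finite"
    and p :: "'n cpoly"
    and u :: "nat \<Rightarrow> complex ^ 'n"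
    and q :: "nat \<Rightarrow> 'n cpoly"
  assumes "d > 2"
    and "v \<noteq> 0"
    and "p = lin_form v ^ d"
    and "orthonormal_basis (inner_at d v) UNIV {1..2 * CARD('n)} u"
    and "u 1 = (1 / (sqrt (real d) * norm v)) *\<^sub>R v"
    and "\<And>i. i \<in> {1..2 * CARD('n)} \<Longrightarrow>
           q i = (sqrt (real d) * norm v powi (- int d + 1)) *\<^sub>R (lin_form (u i) * lin_form v ^ (d - 1))"
  shows "orthonormal_basis (apolar_real d) (veronese_tangent d p) {1..2 * CARD('n)} q"
proof -
  have d: "d > 1" "d > 0"
    using assms(1) by auto
  have "a = 0" if "tangent_map d v a = 0" for a
  proof -
    have "inner_at d v a a = 0"
      using tangent_map_isometry[OF d(1) assms(2), of a a] that
      by (simp add: apolar_real_def apolar_0_left)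
    then show ?thesis
      using norm_le_inner_at[OF d(2), of a v] by simp
  qed
  then have "inj (tangent_map d v)"
    by (simp add: linear_injective_0[OF linear_tangent_map])
  then have "orthonormal_basis (apolar_real d) (range (tangent_map d v)) {1..2 * CARD('n)}
      (\<lambda>i. tangent_map d v (u i))"
    using tangent_map_isometry[OF d(1) assms(2)]
    by (intro orthonormal_basis_linear_image[OF assms(4) linear_tangent_map])
  moreover have "q i = tangent_map d v (u i)" if "i \<in> {1..2 * CARD('n)}" for i
    using assms(6)[OF that] by (simp add: tangent_map_def)
  ultimately show ?thesis
    using orthonormal_basis_cong[of "{1..2 * CARD('n)}" q "\<lambda>i. tangent_map d v (u i)"]
    by (simp add: range_tangent_map[OF d(2) assms(2)] assms(3))
qed

end
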